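(* Let $K$ be a field, let $S=K[t_1,\ldots,t_s]$, $s\geq 2$, be a polynomial ring with the standard grading, and let $\prec$ be a graded monomial order on $S$. Let $I=I(\mathbb{X})\subset S$ be the vanishing ideal of a finite nonempty set $\mathbb{X}$ of points of the projective space $\mathbb{P}^{s-1}$ over $K$, let $d\geq 1$, let $f\in\mathcal{F}_{\prec,d}$, and let ${\rm in}_\prec(f)=t_1^{a_1}\cdots t_s^{a_s}$. If ${\rm in}_\prec(I)$ is generated by $t_2^{d_2},\ldots,t_s^{d_s}$ with $d_2,\ldots,d_s\geq 1$, then there is $r\geq 2$ such that $a_r\geq 1$, $a_i\leq d_i-1$ for $i\geq r$, $a_i=0$ if $2\leq i<r$, and $$ |V_{\mathbb{X}}(f)|\leq d_2\cdots d_s-(d_2-a_2)\cdots(d_s-a_s). $$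
   Context: The vanishing ideal $I(\mathbb{X})$ is the ideal of $S$ generated by the homogeneous polynomials that vanish at all points of $\mathbb{X}$. $V_\mathbb{X}(f)$ is the set of zeros of $f$ in $\mathbb{X}$. A graded monomial order is one that compares monomials first by total degree. ${\rm in}_\prec(f)$ is the leading monomial of $f$. $\Delta_\prec(I)$ is the set of monomials of $S$ not in ${\rm in}_\prec(I)$, and $\mathcal{F}_{\prec,d}$ is the set of nonzero $K$-linear combinations $f$ of monomials in $\Delta_\prec(I)$ of degree $d$ such that $f$ is a zero-divisor of $S/I$, i.e. $(I\colon f)\neq I$. *)

theory Defs
  imports "HOL-Algebra.Ideal" "HOL-Library.Poly_Mapping"
begin

text \<open>
  A monomial \<open>t\<^sub>1\<^bsup>a 1\<^esup> \<dots> t\<^sub>s\<^bsup>a s\<^esup>\<close> is represented by its exponent vector \<open>a :: nat \<Rightarrow>\<^sub>0 nat\<close>, and a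
  polynomial by its finitely supported map from exponent vectors to coefficients. The
  multiplication of \<open>(nat \<Rightarrow>\<^sub>0 nat) \<Rightarrow>\<^sub>0 'k\<close> is the convolution product, so this type is the
  polynomial ring in the variables \<open>t\<^sub>0, t\<^sub>1, t\<^sub>2, \<dots>\<close>; the ring \<open>S = K[t\<^sub>1,\<dots>,t\<^sub>s]\<close> is carved out
  of it as a carrier set.
\<close>

type_synonym expo = "nat \<Rightarrow>\<^sub>0 nat"
type_synonym 'k mpoly = "expo \<Rightarrow>\<^sub>0 'k"

definition monomials :: "nat \<Rightarrow> expo set" where
  "monomials s = {a. Poly_Mapping.keys a \<subseteq> {1..s}}"

definition poly_ring :: "nat \<Rightarrow> 'k::field mpoly ring" where
  "poly_ring s =
    \<lparr>carrier = {f. Poly_Mapping.keys f \<subseteq> monomials s}, mult = (*), one = 1, zero = 0, add = (+)\<rparr>"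

abbreviation pmonom :: "expo \<Rightarrow> 'k::field mpoly" where
  "pmonom a \<equiv> Poly_Mapping.single a 1"

definition total_deg :: "expo \<Rightarrow> nat" where
  "total_deg a = (\<Sum>i\<in>Poly_Mapping.keys a. Poly_Mapping.lookup a i)"

definition homogeneous :: "'k::field mpoly \<Rightarrow> bool" where
  "homogeneous f \<longleftrightarrow> (\<exists>d. \<forall>a\<in>Poly_Mapping.keys f. total_deg a = d)"

definition eval_poly :: "'k::field mpoly \<Rightarrow> (nat \<Rightarrow> 'k) \<Rightarrow> 'k" where
  "eval_poly f v =
    (\<Sum>a\<in>Poly_Mapping.keys f.
       Poly_Mapping.lookup f a * (\<Prod>i\<in>Poly_Mapping.keys a. v i ^ Poly_Mapping.lookup a i))"

lemma cring_poly_ring: "cring (poly_ring s :: 'k::field mpoly ring)"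
proof (rule cringI)
  have add: "f + g \<in> carrier (poly_ring s)"
    if "f \<in> carrier (poly_ring s)" "g \<in> carrier (poly_ring s)" for f g :: "'k mpoly"
    using that Poly_Mapping.keys_add[of f g] by (auto simp: poly_ring_def)
  have mult: "f * g \<in> carrier (poly_ring s)"
    if "f \<in> carrier (poly_ring s)" "g \<in> carrier (poly_ring s)" for f g :: "'k mpoly"
  proof -
    have "a + b \<in> monomials s" if "a \<in> monomials s" "b \<in> monomials s" for a b
      using that Poly_Mapping.keys_add[of a b] by (auto simp: monomials_def)
    then show ?thesis
      using that Poly_Mapping.keys_mult[of f g] by (fastforce simp: poly_ring_def)
  qed
  show "abelian_group (poly_ring s :: 'k mpoly ring)"
  proof (rule abelian_groupI)
    fix f :: "'k mpoly" assume "f \<in> carrier (poly_ring s)"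
    then show "\<exists>g\<in>carrier (poly_ring s). g \<oplus>\<^bsub>poly_ring s\<^esub> f = \<zero>\<^bsub>poly_ring s\<^esub>"
      by (intro bexI[of _ "- f"]) (auto simp: poly_ring_def)
  qed (use add in \<open>auto simp: poly_ring_def add_ac\<close>)
  show "comm_monoid (poly_ring s :: 'k mpoly ring)"
    by (rule comm_monoidI) (use mult in \<open>auto simp: poly_ring_def monomials_def mult_ac\<close>)
qed (auto simp: poly_ring_def distrib_right)

text \<open>
  The space \<open>K\<^sup>s\<close> is encoded by functions vanishing outside \<open>{1..s}\<close>; points of
  \<open>P\<^bsup>s-1\<^esup>\<close> are the classes of nonzero vectors modulo nonzero scalars.
\<close>

definition nonzero_vecs :: "nat \<Rightarrow> (nat \<Rightarrow> 'k::field) set" where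
  "nonzero_vecs s = {v. (\<forall>i. i \<notin> {1..s} \<longrightarrow> v i = 0) \<and> (\<exists>i. v i \<noteq> 0)}"

definition proj_rel :: "nat \<Rightarrow> (nat \<Rightarrow> 'k::field) rel" where
  "proj_rel s = {(v, w). v \<in> nonzero_vecs s \<and> w \<in> nonzero_vecs s \<and>
                         (\<exists>c. c \<noteq> 0 \<and> w = (\<lambda>i. c * v i))}"

definition proj_space :: "nat \<Rightarrow> (nat \<Rightarrow> 'k::field) set set" where
  "proj_space s = nonzero_vecs s // proj_rel s"

lemma equiv_proj_rel: "equiv (nonzero_vecs s :: (nat \<Rightarrow> 'k::field) set) (proj_rel s)"
proof (rule equivI)
  show "refl_on (nonzero_vecs s) (proj_rel s :: (nat \<Rightarrow> 'k) rel)"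
    by (auto simp: refl_on_def proj_rel_def intro!: exI[of _ 1])
  show "sym (proj_rel s :: (nat \<Rightarrow> 'k) rel)"
  proof (rule symI)
    fix v w :: "nat \<Rightarrow> 'k" assume "(v, w) \<in> proj_rel s"
    then obtain c where "v \<in> nonzero_vecs s" "w \<in> nonzero_vecs s" "c \<noteq> 0" "w = (\<lambda>i. c * v i)"
      by (auto simp: proj_rel_def)
    then show "(w, v) \<in> proj_rel s"
      by (auto simp: proj_rel_def mult.assoc[symmetric] intro!: exI[of _ "inverse c"])
  qed
  show "trans (proj_rel s :: (nat \<Rightarrow> 'k) rel)"
  proof (rule transI)
    fix u v w :: "nat \<Rightarrow> 'k" assume "(u, v) \<in> proj_rel s" "(v, w) \<in> proj_rel s"
    then obtain b c where "u \<in> nonzero_vecs s" "w \<in> nonzero_vecs s"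
      "b \<noteq> 0" "v = (\<lambda>i. b * u i)" "c \<noteq> 0" "w = (\<lambda>i. c * v i)"
      by (auto simp: proj_rel_def)
    then show "(u, w) \<in> proj_rel s"
      by (auto simp: proj_rel_def mult.assoc intro!: exI[of _ "c * b"])
  qed
qed (auto simp: proj_rel_def)

text \<open>For homogeneous \<open>f\<close> this does not depend on the chosen representative.\<close>

definition vanishes_at :: "'k::field mpoly \<Rightarrow> (nat \<Rightarrow> 'k) set \<Rightarrow> bool" where
  "vanishes_at f P \<longleftrightarrow> (\<forall>v\<in>P. eval_poly f v = 0)"

definition zeros_in :: "(nat \<Rightarrow> 'k::field) set set \<Rightarrow> 'k mpoly \<Rightarrow> (nat \<Rightarrow> 'k) set set" where
  "zeros_in X f = {P \<in> X. vanishes_at f P}"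

definition vanishing_ideal :: "nat \<Rightarrow> (nat \<Rightarrow> 'k::field) set set \<Rightarrow> 'k mpoly set" where
  "vanishing_ideal s X =
    Idl\<^bsub>poly_ring s\<^esub> {f \<in> carrier (poly_ring s). homogeneous f \<and> (\<forall>P\<in>X. vanishes_at f P)}"

text \<open>
  A monomial order is given by its reflexive version: \<open>(a, b) \<in> ord\<close> means that
  \<open>t\<^sup>a\<close> precedes or equals \<open>t\<^sup>b\<close>.
\<close>

definition monomial_order :: "nat \<Rightarrow> expo rel \<Rightarrow> bool" where
  "monomial_order s ord \<longleftrightarrow>
    linear_order_on (monomials s) ord \<and>
    (\<forall>a\<in>monomials s. (0, a) \<in> ord) \<and>
    (\<forall>a\<in>monomials s. \<forall>b\<in>monomials s. \<forall>c\<in>monomials s.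
       (a, b) \<in> ord \<longrightarrow> (a + c, b + c) \<in> ord)"

definition graded_monomial_order :: "nat \<Rightarrow> expo rel \<Rightarrow> bool" where
  "graded_monomial_order s ord \<longleftrightarrow>
    monomial_order s ord \<and>
    (\<forall>a\<in>monomials s. \<forall>b\<in>monomials s. total_deg a < total_deg b \<longrightarrow> (a, b) \<in> ord)"

text \<open>Exponent vector of the leading monomial; meaningful for \<open>f \<noteq> 0\<close>.\<close>

definition lead_expo :: "expo rel \<Rightarrow> 'k::field mpoly \<Rightarrow> expo" where
  "lead_expo ord f =
    (THE a. a \<in> Poly_Mapping.keys f \<and> (\<forall>b\<in>Poly_Mapping.keys f. (b, a) \<in> ord))"

definition initial_ideal :: "nat \<Rightarrow> expo rel \<Rightarrow> 'k::field mpoly set \<Rightarrow> 'k mpoly set" where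
  "initial_ideal s ord I = Idl\<^bsub>poly_ring s\<^esub> {pmonom (lead_expo ord f) | f. f \<in> I \<and> f \<noteq> 0}"

definition standard_monomials :: "nat \<Rightarrow> expo rel \<Rightarrow> 'k::field mpoly set \<Rightarrow> expo set" where
  "standard_monomials s ord I = {a \<in> monomials s. pmonom a \<notin> initial_ideal s ord I}"

definition colon_ideal :: "nat \<Rightarrow> 'k::field mpoly set \<Rightarrow> 'k mpoly \<Rightarrow> 'k mpoly set" where
  "colon_ideal s I f = {g \<in> carrier (poly_ring s). g * f \<in> I}"

definition zero_divisor_forms ::
    "nat \<Rightarrow> expo rel \<Rightarrow> 'k::field mpoly set \<Rightarrow> nat \<Rightarrow> 'k mpoly set" where
  "zero_divisor_forms s ord I d =
    {f. f \<noteq> 0 \<and> Poly_Mapping.keys f \<subseteq> {a \<in> standard_monomials s ord I. total_deg a = d} \<and>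
        colon_ideal s I f \<noteq> I}"

end

theory Submission
  imports Defs "HOL-Library.Function_Algebras" "HOL.Vector_Spaces"
begin

text \<open>
  Let \<open>a\<close> be the leading exponent of \<open>f\<close>. Some \<open>a\<^sub>r\<close> with \<open>r \<ge> 2\<close> is positive: choose \<open>g \<notin> I\<close> with
  \<open>g f \<in> I\<close> and leading exponent \<open>b\<close> as small as possible; then \<open>t\<^sup>b\<close> is standard, whereas
  \<open>t\<^bsup>a + b\<^esup>\<close> lies in the initial ideal, so \<open>d\<^sub>i \<le> a\<^sub>i + b\<^sub>i\<close> and \<open>b\<^sub>i < d\<^sub>i\<close> for some \<open>i \<ge> 2\<close>.

  For the bound, fix a large degree \<open>n\<close>. Products of linear forms show that the forms of degree
  \<open>n\<close> induce all functions on representatives of the zeros of \<open>f\<close> in \<open>X\<close>. Rewriting with \<open>f\<close> and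
  with homogeneous components of elements of \<open>I\<close>, which vanish at the zeros, shows that the monomials
  of degree \<open>n\<close> divisible neither by \<open>t\<^sup>a\<close> nor by any \<open>t\<^sub>i\<close> to the power \<open>d\<^sub>i\<close> already span these
  functions. For large \<open>n\<close> the exponent of \<open>t\<^sub>1\<close> imposes no condition, and there are
  \<open>\<Prod>d\<^sub>i - \<Prod>(d\<^sub>i - a\<^sub>i)\<close> such monomials.
\<close>

subsection \<open>Monomials\<close>

definition mono_val :: "(nat \<Rightarrow> 'k::field) \<Rightarrow> expo \<Rightarrow> 'k" where
  "mono_val v a = (\<Prod>i\<in>Poly_Mapping.keys a. v i ^ Poly_Mapping.lookup a i)"

text \<open>Indices outside the support contribute the factor 1. Passing to a common finite index
  set is what lets monomials with different supports be compared.\<close>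

lemma mono_val_superset:
  assumes "finite T" "Poly_Mapping.keys a \<subseteq> T"
  shows "mono_val v a = (\<Prod>i\<in>T. v i ^ Poly_Mapping.lookup a i)"
  unfolding mono_val_def
  by (rule prod.mono_neutral_left) (use assms in \<open>auto simp: in_keys_iff\<close>)

lemma total_deg_superset:
  assumes "finite T" "Poly_Mapping.keys a \<subseteq> T"
  shows "total_deg a = (\<Sum>i\<in>T. Poly_Mapping.lookup a i)"
  unfolding total_deg_def
  by (rule sum.mono_neutral_left) (use assms in \<open>auto simp: in_keys_iff\<close>)

lemma mono_val_add: "mono_val v (a + b) = mono_val v a * mono_val v b"
proof -
  let ?T = "Poly_Mapping.keys a \<union> Poly_Mapping.keys b"
  have "Poly_Mapping.keys (a + b) \<subseteq> ?T"
    by (rule Poly_Mapping.keys_add)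
  then show ?thesis
    by (simp add: mono_val_superset[of ?T] lookup_add power_add prod.distrib)
qed

lemma total_deg_add: "total_deg (a + b) = total_deg a + total_deg b"
proof -
  let ?T = "Poly_Mapping.keys a \<union> Poly_Mapping.keys b"
  have "Poly_Mapping.keys (a + b) \<subseteq> ?T"
    by (rule Poly_Mapping.keys_add)
  then show ?thesis
    by (simp add: total_deg_superset[of ?T] lookup_add sum.distrib)
qed

lemma mono_val_single [simp]: "mono_val v (Poly_Mapping.single i 1) = v i"
  by (simp add: mono_val_def)

lemma total_deg_single [simp]: "total_deg (Poly_Mapping.single i n) = n"
  by (simp add: total_deg_def)

lemma monomials_add: "a \<in> monomials s \<Longrightarrow> b \<in> monomials s \<Longrightarrow> a + b \<in> monomials s"
  using Poly_Mapping.keys_add[of a b] by (auto simp: monomials_def)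

lemma monomials_zero [simp]: "0 \<in> monomials s"
  by (simp add: monomials_def)

lemma monomials_single: "i \<in> {1..s} \<Longrightarrow> Poly_Mapping.single i n \<in> monomials s"
  by (simp add: monomials_def)

lemma monomials_factor:
  assumes "b \<in> monomials s" "\<forall>i. Poly_Mapping.lookup a i \<le> Poly_Mapping.lookup b i"
  obtains c where "c \<in> monomials s" "b = a + c"
proof
  show "b = a + (b - a)"
    using assms(2) by (intro poly_mapping_eqI) (simp add: lookup_add lookup_minus)
  show "b - a \<in> monomials s"
    using assms(1) by (auto simp: monomials_def in_keys_iff lookup_minus)
qed

text \<open>Each exponent is bounded by the total degree, so these monomials embed into the
  functions from \<open>{1..s}\<close> to \<open>{..n}\<close>. This finiteness later turns a graded
  order into a numerical rank.\<close>

lemma finite_monomials_le: "finite {a \<in> monomials s. total_deg a \<le> n}"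
proof (rule finite_imageD)
  have "Poly_Mapping.lookup a i \<le> n" if "a \<in> monomials s" "total_deg a \<le> n" for a i
  proof (cases "i \<in> Poly_Mapping.keys a")
    case True
    then have "Poly_Mapping.lookup a i \<le> total_deg a"
      unfolding total_deg_def by (intro member_le_sum) auto
    with that show ?thesis by simp
  qed (simp add: in_keys_iff)
  then have "(\<lambda>a. \<lambda>i. Poly_Mapping.lookup a i) ` {a \<in> monomials s. total_deg a \<le> n}
      \<subseteq> {h. \<forall>i. (i \<in> {1..s} \<longrightarrow> h i \<in> {..n}) \<and> (i \<notin> {1..s} \<longrightarrow> h i = 0)}"
    by (auto simp: monomials_def in_keys_iff)
  moreover have "finite {h. \<forall>i. (i \<in> {1..s} \<longrightarrow> h i \<in> {..n}) \<and> (i \<notin> {1..s} \<longrightarrow> h i = (0::nat))}"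
    by (rule finite_set_of_finite_funs) auto
  ultimately show "finite ((\<lambda>a. \<lambda>i. Poly_Mapping.lookup a i) ` {a \<in> monomials s. total_deg a \<le> n})"
    by (rule finite_subset)
qed (auto simp: inj_on_def intro: poly_mapping_eqI)

text \<open>The step adds an arbitrary term, with no freshness condition on its exponent, so for an
  additive construction only single terms remain to be checked.\<close>

lemma mpoly_induct [case_names zero single_add]:
  fixes h :: "'k::field mpoly"
  assumes "P 0" "\<And>a c h. P h \<Longrightarrow> P (Poly_Mapping.single a c + h)"
  shows "P h"
proof (induction h rule: update_induct)
  case (update h a b)
  have "Poly_Mapping.update a b h = Poly_Mapping.single a b + h"
    using update(1)
    by (intro poly_mapping_eqI) (auto simp: lookup_update lookup_add lookup_single in_keys_iff when_def)
  with assms(2) update show ?case by metis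
qed (use assms in auto)

lemma lookup_single_times:
  fixes h :: "'k::field mpoly"
  shows "Poly_Mapping.lookup (Poly_Mapping.single c x * h) (c + k) = x * Poly_Mapping.lookup h k"
  by (induction h rule: mpoly_induct)
    (simp_all add: distrib_left lookup_add mult_single lookup_single when_def)


subsection \<open>Ideals of the polynomial ring\<close>

lemma poly_ring_simps [simp]:
  "f \<in> carrier (poly_ring s) \<longleftrightarrow> Poly_Mapping.keys f \<subseteq> monomials s"
  "f \<otimes>\<^bsub>poly_ring s\<^esub> g = f * g" "f \<oplus>\<^bsub>poly_ring s\<^esub> g = f + g"
  "\<zero>\<^bsub>poly_ring s\<^esub> = 0" "\<one>\<^bsub>poly_ring s\<^esub> = 1"
  by (simp_all add: poly_ring_def)

lemma poly_ring_mult_closed: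
  fixes f g :: "'k::field mpoly"
  assumes "Poly_Mapping.keys f \<subseteq> monomials s" "Poly_Mapping.keys g \<subseteq> monomials s"
  shows "Poly_Mapping.keys (f * g) \<subseteq> monomials s"
  using assms Poly_Mapping.keys_mult[of f g] by (fastforce intro: monomials_add)

text \<open>Closure under negation comes for free: \<open>- h\<close> is the multiple
  \<open>(-1) * h\<close>.\<close>

lemma poly_ring_idealI:
  fixes I :: "'k::field mpoly set"
  assumes sub: "\<And>h. h \<in> I \<Longrightarrow> Poly_Mapping.keys h \<subseteq> monomials s"
    and zero: "0 \<in> I"
    and add: "\<And>g h. g \<in> I \<Longrightarrow> h \<in> I \<Longrightarrow> g + h \<in> I"
    and mult: "\<And>g h. g \<in> I \<Longrightarrow> Poly_Mapping.keys h \<subseteq> monomials s \<Longrightarrow> h * g \<in> I"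
  shows "ideal I (poly_ring s)"
proof -
  interpret R: cring "poly_ring s :: 'k mpoly ring"
    by (rule cring_poly_ring)
  have inv: "\<ominus>\<^bsub>poly_ring s\<^esub> h = (-1) * h" if "h \<in> I" for h
    using sub[OF that] by (intro R.minus_equality) auto
  have minus1: "Poly_Mapping.keys (-1 :: 'k mpoly) \<subseteq> monomials s"
    by simp
  show ?thesis
  proof (rule idealI)
    show "subgroup I (add_monoid (poly_ring s))"
    proof
      show "inv\<^bsub>add_monoid (poly_ring s)\<^esub> h \<in> I" if "h \<in> I" for h
        using mult[OF that minus1] inv[OF that] by (simp add: a_inv_def)
    qed (use sub zero add in \<open>auto simp: poly_ring_def\<close>)
  qed (use mult in \<open>auto simp: mult.commute intro: R.ring_axioms\<close>)
qed

lemma poly_ring_idealD: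
  fixes I :: "'k::field mpoly set"
  assumes "ideal I (poly_ring s)"
  shows poly_ring_ideal_carrier: "\<And>h. h \<in> I \<Longrightarrow> Poly_Mapping.keys h \<subseteq> monomials s"
    and poly_ring_ideal_zero: "0 \<in> I"
    and poly_ring_ideal_add: "\<And>g h. g \<in> I \<Longrightarrow> h \<in> I \<Longrightarrow> g + h \<in> I"
    and poly_ring_ideal_mult:
      "\<And>g h. g \<in> I \<Longrightarrow> Poly_Mapping.keys h \<subseteq> monomials s \<Longrightarrow> h * g \<in> I"
proof -
  interpret I: ideal I "poly_ring s" by (rule assms)
  show "\<And>h. h \<in> I \<Longrightarrow> Poly_Mapping.keys h \<subseteq> monomials s"
    using I.Icarr by simp
  show "0 \<in> I"
    using additive_subgroup.zero_closed[OF ideal.axioms(1)[OF assms]] by simp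
  show "\<And>g h. g \<in> I \<Longrightarrow> h \<in> I \<Longrightarrow> g + h \<in> I"
    using additive_subgroup.a_closed[OF ideal.axioms(1)[OF assms]] by simp
  show "\<And>g h. g \<in> I \<Longrightarrow> Poly_Mapping.keys h \<subseteq> monomials s \<Longrightarrow> h * g \<in> I"
    using I.I_l_closed by simp
qed

text \<open>The polynomials all of whose exponents are divisible by some member of \<open>B\<close>
  form an ideal containing the generators, hence containing the generated ideal. Conversely a
  monomial divisible by a generator is a multiple of it.\<close>

lemma pmonom_mem_monomial_ideal_iff:
  assumes B: "B \<subseteq> monomials s" and a: "a \<in> monomials s"
  shows "(pmonom a :: 'k::field mpoly) \<in> Idl\<^bsub>poly_ring s\<^esub> (pmonom ` B) \<longleftrightarrow>
    (\<exists>b\<in>B. \<forall>i. Poly_Mapping.lookup b i \<le> Poly_Mapping.lookup a i)"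
proof
  interpret R: cring "poly_ring s :: 'k mpoly ring"
    by (rule cring_poly_ring)
  let ?J = "{h :: 'k mpoly. Poly_Mapping.keys h \<subseteq> monomials s \<and> (\<forall>k\<in>Poly_Mapping.keys h.
    \<exists>b\<in>B. \<forall>i. Poly_Mapping.lookup b i \<le> Poly_Mapping.lookup k i)}"
  have "ideal ?J (poly_ring s)"
  proof (rule poly_ring_idealI)
    fix g h :: "'k mpoly"
    assume g: "g \<in> ?J"
    show "g + h \<in> ?J" if "h \<in> ?J"
      using g that Poly_Mapping.keys_add[of g h] by blast
    assume h: "Poly_Mapping.keys h \<subseteq> monomials s"
    have "\<exists>b\<in>B. \<forall>i. Poly_Mapping.lookup b i \<le> Poly_Mapping.lookup k i"
      if k: "k \<in> Poly_Mapping.keys (h * g)" for k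
    proof -
      obtain p q where "k = p + q" "q \<in> Poly_Mapping.keys g"
        using subsetD[OF Poly_Mapping.keys_mult k] by blast
      with g show ?thesis
        by (fastforce simp: lookup_add intro: trans_le_add2)
    qed
    with g h show "h * g \<in> ?J"
      using poly_ring_mult_closed by blast
  qed auto
  moreover have "pmonom ` B \<subseteq> ?J"
    using B by auto
  ultimately have "Idl\<^bsub>poly_ring s\<^esub> (pmonom ` B) \<subseteq> ?J"
    by (rule R.genideal_minimal)
  moreover assume "(pmonom a :: 'k mpoly) \<in> Idl\<^bsub>poly_ring s\<^esub> (pmonom ` B)"
  ultimately show "\<exists>b\<in>B. \<forall>i. Poly_Mapping.lookup b i \<le> Poly_Mapping.lookup a i"
    by auto
next
  interpret R: cring "poly_ring s :: 'k mpoly ring"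
    by (rule cring_poly_ring)
  have gens: "pmonom ` B \<subseteq> carrier (poly_ring s :: 'k mpoly ring)"
    using B by auto
  assume "\<exists>b\<in>B. \<forall>i. Poly_Mapping.lookup b i \<le> Poly_Mapping.lookup a i"
  then obtain b c where b: "b \<in> B" and c: "c \<in> monomials s" "a = b + c"
    using monomials_factor[OF a] by metis
  have "(pmonom b :: 'k mpoly) \<in> Idl\<^bsub>poly_ring s\<^esub> (pmonom ` B)"
    using R.genideal_self[OF gens] b by blast
  then have "pmonom c * (pmonom b :: 'k mpoly) \<in> Idl\<^bsub>poly_ring s\<^esub> (pmonom ` B)"
    using c by (intro poly_ring_ideal_mult[OF R.genideal_ideal[OF gens]]) auto
  then show "(pmonom a :: 'k mpoly) \<in> Idl\<^bsub>poly_ring s\<^esub> (pmonom ` B)"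
    by (simp add: mult_single c add.commute)
qed


subsection \<open>Homogeneous components of the vanishing ideal\<close>

text \<open>The polynomial \<open>h(z v\<^sub>1, \<dots>, z v\<^sub>s) \<in> K[z]\<close>: its coefficients are the values at \<open>v\<close> of the
  homogeneous components of \<open>h\<close>, and it depends multiplicatively on \<open>h\<close>.\<close>

definition ray_poly :: "(nat \<Rightarrow> 'k::field) \<Rightarrow> 'k mpoly \<Rightarrow> nat \<Rightarrow>\<^sub>0 'k" where
  "ray_poly v h = (\<Sum>a\<in>Poly_Mapping.keys h.
     Poly_Mapping.single (total_deg a) (Poly_Mapping.lookup h a * mono_val v a))"

lemma ray_poly_zero [simp]: "ray_poly v 0 = 0"
  by (simp add: ray_poly_def)

lemma ray_poly_single:
  "ray_poly v (Poly_Mapping.single a c) = Poly_Mapping.single (total_deg a) (c * mono_val v a)"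
  by (simp add: ray_poly_def)

lemma ray_poly_add: "ray_poly v (g + h) = ray_poly v g + ray_poly v h"
  unfolding ray_poly_def
  by (rule setsum_keys_plus_distrib) (simp_all add: single_add distrib_right)

lemma ray_poly_mult: "ray_poly v (g * h) = ray_poly v g * ray_poly v h"
proof (induction g rule: mpoly_induct)
  case (single_add a c g)
  have "ray_poly v (Poly_Mapping.single a c * h) =
      ray_poly v (Poly_Mapping.single a c) * ray_poly v h"
    by (induction h rule: mpoly_induct)
      (simp_all add: distrib_left ray_poly_add ray_poly_single mult_single total_deg_add
        mono_val_add mult_ac)
  with single_add show ?case
    by (simp add: distrib_right ray_poly_add)
qed simp

lemma lookup_ray_poly:
  "Poly_Mapping.lookup (ray_poly v h) n =
    (\<Sum>a | a \<in> Poly_Mapping.keys h \<and> total_deg a = n. Poly_Mapping.lookup h a * mono_val v a)"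
  unfolding ray_poly_def lookup_sum
  by (rule sum.mono_neutral_cong_right) (auto simp: lookup_single when_def)

lemma eval_poly_mono_val:
  "eval_poly h v = (\<Sum>a\<in>Poly_Mapping.keys h. Poly_Mapping.lookup h a * mono_val v a)"
  by (simp add: eval_poly_def mono_val_def)

text \<open>A form of degree \<open>d\<close> gives the single term \<open>h(v) z^d\<close>.\<close>

lemma ray_poly_homogeneous:
  assumes "homogeneous h" "eval_poly h v = 0"
  shows "ray_poly v h = 0"
proof -
  from assms(1) obtain d where d: "\<forall>a\<in>Poly_Mapping.keys h. total_deg a = d"
    by (auto simp: homogeneous_def)
  then have "ray_poly v h = Poly_Mapping.single d (eval_poly h v)"
    by (intro poly_mapping_eqI) (auto simp: ray_poly_def eval_poly_mono_val lookup_sum lookup_single when_def)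
  with assms(2) show ?thesis by simp
qed

lemma vanishing_ideal_ideal: "ideal (vanishing_ideal s X) (poly_ring s :: 'k::field mpoly ring)"
proof -
  interpret R: cring "poly_ring s :: 'k mpoly ring"
    by (rule cring_poly_ring)
  show ?thesis
    unfolding vanishing_ideal_def by (rule R.genideal_ideal) auto
qed

text \<open>The kernel of \<open>ray_poly v\<close> is an ideal containing the homogeneous
  generators. So every homogeneous component of \<open>h\<close> vanishes at \<open>v\<close>, not
  just their sum. Scaling \<open>v\<close> would not show this over a finite field, where a nonzero
  polynomial in \<open>z\<close> can vanish everywhere.\<close>

lemma vanishing_ideal_ray_poly:
  fixes X :: "(nat \<Rightarrow> 'k::field) set set"
  assumes "h \<in> vanishing_ideal s X" "P \<in> X" "v \<in> P"
  shows "ray_poly v h = 0"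
proof -
  interpret R: cring "poly_ring s :: 'k mpoly ring"
    by (rule cring_poly_ring)
  have "ideal {h. Poly_Mapping.keys h \<subseteq> monomials s \<and> ray_poly v h = 0} (poly_ring s)"
  proof (rule poly_ring_idealI)
    fix g h :: "'k mpoly"
    assume g: "g \<in> {h. Poly_Mapping.keys h \<subseteq> monomials s \<and> ray_poly v h = 0}"
    show "g + h \<in> {h. Poly_Mapping.keys h \<subseteq> monomials s \<and> ray_poly v h = 0}"
      if "h \<in> {h. Poly_Mapping.keys h \<subseteq> monomials s \<and> ray_poly v h = 0}"
      using g that Poly_Mapping.keys_add[of g h] by (auto simp: ray_poly_add)
    show "h * g \<in> {h. Poly_Mapping.keys h \<subseteq> monomials s \<and> ray_poly v h = 0}"
      if "Poly_Mapping.keys h \<subseteq> monomials s"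
      using g poly_ring_mult_closed[OF that, of g] by (simp add: ray_poly_mult)
  qed auto
  then have "vanishing_ideal s X \<subseteq> {h. Poly_Mapping.keys h \<subseteq> monomials s \<and> ray_poly v h = 0}"
    unfolding vanishing_ideal_def
    by (rule R.genideal_minimal)
      (use assms(2,3) in \<open>auto simp: vanishes_at_def intro: ray_poly_homogeneous\<close>)
  with assms(1) show ?thesis by blast
qed


subsection \<open>Graded monomial orders\<close>

context
  fixes s :: nat and ord :: "expo rel"
  assumes ord: "graded_monomial_order s ord"
begin

lemma
  shows ord_refl: "a \<in> monomials s \<Longrightarrow> (a, a) \<in> ord"
    and ord_trans: "(a, b) \<in> ord \<Longrightarrow> (b, c) \<in> ord \<Longrightarrow> (a, c) \<in> ord"
    and ord_antisym: "(a, b) \<in> ord \<Longrightarrow> (b, a) \<in> ord \<Longrightarrow> a = b"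
    and ord_total: "a \<in> monomials s \<Longrightarrow> b \<in> monomials s \<Longrightarrow> (a, b) \<in> ord \<or> (b, a) \<in> ord"
    and ord_monomials: "(a, b) \<in> ord \<Longrightarrow> a \<in> monomials s \<and> b \<in> monomials s"
    and ord_add: "(a, b) \<in> ord \<Longrightarrow> c \<in> monomials s \<Longrightarrow> (a + c, b + c) \<in> ord"
    and ord_graded: "(a, b) \<in> ord \<Longrightarrow> total_deg a \<le> total_deg b"
proof -
  have lin: "linear_order_on (monomials s) ord"
    using ord by (simp add: graded_monomial_order_def monomial_order_def)
  then have *: "ord \<subseteq> monomials s \<times> monomials s" "refl_on (monomials s) ord" "trans ord"
      "antisym ord" "total_on (monomials s) ord"
    by (auto simp: order_on_defs)
  show refl: "(a, a) \<in> ord" if "a \<in> monomials s" for a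
    using *(2) that by (rule refl_onD)
  show "(a, c) \<in> ord" if "(a, b) \<in> ord" "(b, c) \<in> ord" for a b c
    using *(3) that by (rule transD)
  show antisym: "a = b" if "(a, b) \<in> ord" "(b, a) \<in> ord" for a b
    using *(4) that by (rule antisymD)
  show "(a, b) \<in> ord \<or> (b, a) \<in> ord" if "a \<in> monomials s" "b \<in> monomials s" for a b
    using *(5) that refl by (cases "a = b") (auto simp: total_on_def)
  show mon: "a \<in> monomials s \<and> b \<in> monomials s" if "(a, b) \<in> ord" for a b
    using *(1) that by blast
  show "(a + c, b + c) \<in> ord" if "(a, b) \<in> ord" "c \<in> monomials s" for a b c
    using ord mon[OF that(1)] that unfolding graded_monomial_order_def monomial_order_def by simp
  show "total_deg a \<le> total_deg b" if "(a, b) \<in> ord" for a b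
  proof (rule ccontr)
    assume less: "\<not> total_deg a \<le> total_deg b"
    with mon[OF that] ord have "(b, a) \<in> ord"
      unfolding graded_monomial_order_def by simp
    from antisym[OF that this] less show False by simp
  qed
qed

text \<open>A graded order is well-founded because each monomial has finitely many predecessors.\<close>

definition ord_rank :: "expo \<Rightarrow> nat" where
  "ord_rank a = card {b. (b, a) \<in> ord}"

text \<open>Descent in the order becomes descent of natural numbers: \<open>b\<close> precedes
  itself but, by antisymmetry, does not precede \<open>a\<close>.\<close>

lemma ord_rank_less:
  assumes "(a, b) \<in> ord" "a \<noteq> b"
  shows "ord_rank a < ord_rank b"
  unfolding ord_rank_def
proof (rule psubset_card_mono)
  show "finite {c. (c, b) \<in> ord}"
    by (rule finite_subset[OF _ finite_monomials_le[of s "total_deg b"]])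
      (use ord_monomials ord_graded in blast)
  have "b \<in> {c. (c, b) \<in> ord} - {c. (c, a) \<in> ord}"
    using assms ord_antisym ord_refl ord_monomials by blast
  then show "{c. (c, a) \<in> ord} \<subset> {c. (c, b) \<in> ord}"
    using assms(1) ord_trans by blast
qed

text \<open>Justifies the definite description: a finite nonempty set of monomials has exactly one
  greatest element in a linear order.\<close>

lemma lead_expo:
  fixes h :: "'k::field mpoly"
  assumes "h \<noteq> 0" "Poly_Mapping.keys h \<subseteq> monomials s"
  shows lead_expo_in_keys: "lead_expo ord h \<in> Poly_Mapping.keys h"
    and lead_expo_greatest: "b \<in> Poly_Mapping.keys h \<Longrightarrow> (b, lead_expo ord h) \<in> ord"
proof -
  have max: "\<exists>a\<in>A. \<forall>b\<in>A. (b, a) \<in> ord" if "finite A" "A \<noteq> {}" "A \<subseteq> monomials s" for A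
    using that
  proof (induction rule: finite_ne_induct)
    case (insert x A)
    then obtain a where a: "a \<in> A" "\<forall>b\<in>A. (b, a) \<in> ord"
      by auto
    have x: "x \<in> monomials s" "(x, x) \<in> ord"
      using insert ord_refl by auto
    consider "(x, a) \<in> ord" | "(a, x) \<in> ord"
      using ord_total[of x a] a x insert by blast
    then show ?case
    proof cases
      case 1
      with a show ?thesis by (intro bexI[of _ a]) auto
    next
      case 2
      with a x ord_trans show ?thesis by (intro bexI[of _ x]) blast+
    qed
  qed (use ord_refl in auto)
  have "\<exists>!a. a \<in> Poly_Mapping.keys h \<and> (\<forall>b\<in>Poly_Mapping.keys h. (b, a) \<in> ord)"
    using max[of "Poly_Mapping.keys h"] assms ord_antisym by auto
  from theI'[OF this] show "lead_expo ord h \<in> Poly_Mapping.keys h"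
    "b \<in> Poly_Mapping.keys h \<Longrightarrow> (b, lead_expo ord h) \<in> ord"
    by (simp_all add: lead_expo_def)
qed

lemma lead_expo_eqI:
  assumes "a \<in> Poly_Mapping.keys h" "\<And>b. b \<in> Poly_Mapping.keys h \<Longrightarrow> (b, a) \<in> ord"
  shows "lead_expo ord h = a"
  unfolding lead_expo_def
  by (rule the_equality) (use assms in \<open>auto intro: ord_antisym\<close>)

text \<open>Both claims come from the chain \<open>p + q\<close>, \<open>a + q\<close>,
  \<open>a + b\<close>. Equal ends force equality throughout, and cancellation follows. Hence the
  product of two leading terms cannot be cancelled by other terms.\<close>

lemma ord_add_strict:
  assumes "(p, a) \<in> ord" "(q, b) \<in> ord"
  shows "(p + q, a + b) \<in> ord" "p + q = a + b \<Longrightarrow> p = a \<and> q = b"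
proof -
  have 1: "(p + q, a + q) \<in> ord"
    using assms ord_add ord_monomials by blast
  have 2: "(a + q, a + b) \<in> ord"
    using assms ord_add[of q b a] ord_monomials by (simp add: add.commute)
  show "(p + q, a + b) \<in> ord"
    using ord_trans[OF 1 2] .
  assume "p + q = a + b"
  with 1 2 have "a + q = a + b"
    using ord_antisym by metis
  with \<open>p + q = a + b\<close> show "p = a \<and> q = b"
    by simp
qed

lemma lead_expo_mult:
  fixes g h :: "'k::field mpoly"
  assumes g: "g \<noteq> 0" "Poly_Mapping.keys g \<subseteq> monomials s"
    and h: "h \<noteq> 0" "Poly_Mapping.keys h \<subseteq> monomials s"
  shows lead_expo_mult_eq: "lead_expo ord (g * h) = lead_expo ord g + lead_expo ord h"
    and mult_mpoly_nonzero: "g * h \<noteq> 0"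
proof -
  define a b where "a = lead_expo ord g" and "b = lead_expo ord h"
  define c d where "c = Poly_Mapping.lookup g a" and "d = Poly_Mapping.lookup h b"
  define g' h' where "g' = g - Poly_Mapping.single a c" and "h' = h - Poly_Mapping.single b d"
  have cd: "c \<noteq> 0" "d \<noteq> 0"
    using lead_expo_in_keys[OF g] lead_expo_in_keys[OF h]
    by (simp_all add: a_def b_def c_def d_def in_keys_iff)
  have g': "(p, a) \<in> ord \<and> p \<noteq> a" if "p \<in> Poly_Mapping.keys g'" for p
  proof -
    have "p \<noteq> a"
      using that by (auto simp: g'_def c_def in_keys_iff lookup_minus)
    with that have "p \<in> Poly_Mapping.keys g"
      by (simp add: g'_def in_keys_iff lookup_minus lookup_single)
    with \<open>p \<noteq> a\<close> show ?thesis
      using lead_expo_greatest[OF g] a_def by blast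
  qed
  have h': "(q, b) \<in> ord \<and> q \<noteq> b" if "q \<in> Poly_Mapping.keys h'" for q
  proof -
    have "q \<noteq> b"
      using that by (auto simp: h'_def d_def in_keys_iff lookup_minus)
    with that have "q \<in> Poly_Mapping.keys h"
      by (simp add: h'_def in_keys_iff lookup_minus lookup_single)
    with \<open>q \<noteq> b\<close> show ?thesis
      using lead_expo_greatest[OF h] b_def by blast
  qed
  have a: "(a, a) \<in> ord"
    using lead_expo_greatest[OF g lead_expo_in_keys[OF g]] by (simp add: a_def)
  \<comment> \<open>Isolates the product of the leading terms; every term of the two remaining
    products has a factor strictly below \<open>a\<close> or \<open>b\<close>.\<close>
  have eq: "g * h = Poly_Mapping.single (a + b) (c * d) + (Poly_Mapping.single a c * h' + g' * h)"
    by (simp add: g'_def h'_def mult_single[symmetric] algebra_simps)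
  have 1: "a + b \<notin> Poly_Mapping.keys (Poly_Mapping.single a c * h')"
  proof
    assume "a + b \<in> Poly_Mapping.keys (Poly_Mapping.single a c * h')"
    from subsetD[OF Poly_Mapping.keys_mult this]
    obtain p q where "a + b = p + q" "p \<in> Poly_Mapping.keys (Poly_Mapping.single a c)"
        "q \<in> Poly_Mapping.keys h'"
      by blast
    with h' cd show False by (auto split: if_splits)
  qed
  have 2: "a + b \<notin> Poly_Mapping.keys (g' * h)"
  proof
    assume "a + b \<in> Poly_Mapping.keys (g' * h)"
    from subsetD[OF Poly_Mapping.keys_mult this]
    obtain p q where "p + q = a + b" "p \<in> Poly_Mapping.keys g'" "q \<in> Poly_Mapping.keys h"
      by auto
    then show False
      using ord_add_strict(2)[of p a q b] g' lead_expo_greatest[OF h] b_def by blast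
  qed
  have "Poly_Mapping.lookup (g * h) (a + b) = c * d"
    using 1 2 by (simp add: eq lookup_add in_keys_iff)
  with cd have key: "a + b \<in> Poly_Mapping.keys (g * h)"
    by (simp add: in_keys_iff)
  then show "g * h \<noteq> 0"
    by auto
  show "lead_expo ord (g * h) = lead_expo ord g + lead_expo ord h"
    unfolding a_def[symmetric] b_def[symmetric]
  proof (rule lead_expo_eqI[OF key])
    fix k assume "k \<in> Poly_Mapping.keys (g * h)"
    from subsetD[OF Poly_Mapping.keys_mult this]
    obtain p q where "k = p + q" "p \<in> Poly_Mapping.keys g" "q \<in> Poly_Mapping.keys h"
      by auto
    then show "(k, a + b) \<in> ord"
      using ord_add_strict(1)[of p a q b] lead_expo_greatest[OF g] lead_expo_greatest[OF h]
      by (simp add: a_def b_def)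
  qed
qed

lemma pmonom_mem_initial_ideal_iff:
  fixes I :: "'k::field mpoly set"
  assumes I: "ideal I (poly_ring s)" and b: "b \<in> monomials s"
  shows "(pmonom b :: 'k mpoly) \<in> initial_ideal s ord I \<longleftrightarrow>
    (\<exists>h\<in>I. h \<noteq> 0 \<and>
      (\<forall>i. Poly_Mapping.lookup (lead_expo ord h) i \<le> Poly_Mapping.lookup b i))"
proof -
  have eq: "{pmonom (lead_expo ord f) | f. f \<in> I \<and> f \<noteq> 0} =
      (pmonom ` lead_expo ord ` {f \<in> I. f \<noteq> 0} :: 'k mpoly set)"
    by auto
  have "lead_expo ord ` {f \<in> I. f \<noteq> 0} \<subseteq> monomials s"
    using lead_expo_in_keys poly_ring_ideal_carrier[OF I] by blast
  from pmonom_mem_monomial_ideal_iff[OF this b] show ?thesis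
    unfolding initial_ideal_def eq by (simp add: Bex_def conj_assoc)
qed

text \<open>Among the elements of the colon ideal outside \<open>I\<close>, one with least leading
  exponent works. If its leading monomial were in the initial ideal, a multiple of some
  \<open>h\<close> in \<open>I\<close> would cancel it and leave a smaller element of the same
  kind.\<close>

lemma colon_ideal_standard_witness:
  fixes I :: "'k::field mpoly set"
  assumes I: "ideal I (poly_ring s)" and f: "Poly_Mapping.keys f \<subseteq> monomials s"
    and colon: "colon_ideal s I f \<noteq> I"
  obtains g where "g \<noteq> 0" "Poly_Mapping.keys g \<subseteq> monomials s" "g * f \<in> I"
    "pmonom (lead_expo ord g) \<notin> initial_ideal s ord I"
proof -
  have "I \<subseteq> colon_ideal s I f"
    using poly_ring_ideal_carrier[OF I] poly_ring_ideal_mult[OF I _ f]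
    by (auto simp: colon_ideal_def mult.commute)
  with colon obtain g0 where g0: "g0 \<in> colon_ideal s I f - I"
    by blast
  define g where "g = arg_min (\<lambda>g. ord_rank (lead_expo ord g)) (\<lambda>g. g \<in> colon_ideal s I f - I)"
  have mem: "g \<in> colon_ideal s I f - I"
    unfolding g_def using g0 by (rule arg_min_natI)
  have min: "ord_rank (lead_expo ord g) \<le> ord_rank (lead_expo ord g')"
    if "g' \<in> colon_ideal s I f - I" for g'
    unfolding g_def using that by (rule arg_min_nat_le)
  have g: "g \<noteq> 0" "Poly_Mapping.keys g \<subseteq> monomials s" "g * f \<in> I" "g \<notin> I"
    using mem poly_ring_ideal_zero[OF I] by (auto simp: colon_ideal_def)
  define b where "b = lead_expo ord g"
  have b: "b \<in> Poly_Mapping.keys g" "b \<in> monomials s"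
    using lead_expo_in_keys[OF g(1,2)] g(2) by (auto simp: b_def)
  have "pmonom b \<notin> initial_ideal s ord I"
  proof
    assume "pmonom b \<in> initial_ideal s ord I"
    then obtain h where h: "h \<in> I" "h \<noteq> 0"
      "\<forall>i. Poly_Mapping.lookup (lead_expo ord h) i \<le> Poly_Mapping.lookup b i"
      using pmonom_mem_initial_ideal_iff[OF I b(2)] by blast
    obtain c where c: "c \<in> monomials s" "b = lead_expo ord h + c"
      using monomials_factor[OF b(2) h(3)] by blast
    note hk = poly_ring_ideal_carrier[OF I h(1)]
    \<comment> \<open>The coefficient makes the term of \<open>m * h\<close> at \<open>b\<close>
      opposite to that of \<open>g\<close>.\<close>
    define m where "m = Poly_Mapping.single c
      (- Poly_Mapping.lookup g b / Poly_Mapping.lookup h (lead_expo ord h))"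
    have m: "m \<noteq> 0" "Poly_Mapping.keys m \<subseteq> monomials s" "lead_expo ord m = c"
    proof -
      have x: "- Poly_Mapping.lookup g b / Poly_Mapping.lookup h (lead_expo ord h) \<noteq> 0"
        using b(1) lead_expo_in_keys[OF h(2) hk] by (simp add: in_keys_iff)
      then show "m \<noteq> 0" "Poly_Mapping.keys m \<subseteq> monomials s" "lead_expo ord m = c"
        using c(1) unfolding m_def
        by (auto simp del: divide_eq_0_iff intro!: lead_expo_eqI ord_refl simp flip: keys_eq_empty)
    qed
    have mh: "m * h \<in> I"
      by (rule poly_ring_ideal_mult[OF I h(1) m(2)])
    have "Poly_Mapping.lookup (m * h) b = - Poly_Mapping.lookup g b"
      using b(1) lead_expo_in_keys[OF h(2) hk] lookup_single_times[of c _ h "lead_expo ord h"]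
      by (simp add: m_def c(2) add.commute in_keys_iff)
    then have nb: "b \<notin> Poly_Mapping.keys (g + m * h)"
      by (simp add: in_keys_iff lookup_add)
    have lt: "(k, b) \<in> ord" if "k \<in> Poly_Mapping.keys (g + m * h)" for k
    proof -
      have "k \<in> Poly_Mapping.keys g \<or> k \<in> Poly_Mapping.keys (m * h)"
        using subsetD[OF Poly_Mapping.keys_add that] by blast
      moreover have "lead_expo ord (m * h) = b"
        using lead_expo_mult_eq[OF m(1,2) h(2) hk] by (simp add: m c add.commute)
      ultimately show ?thesis
        using lead_expo_greatest[OF g(1,2)]
          lead_expo_greatest[OF mult_mpoly_nonzero[OF m(1,2) h(2) hk]
            poly_ring_ideal_carrier[OF I mh]]
        by (auto simp: b_def)
    qed
    \<comment> \<open>Adding an element of \<open>I\<close> changes neither membership in the colon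
      ideal nor non-membership in \<open>I\<close>.\<close>
    have gm: "g + m * h \<in> colon_ideal s I f - I"
    proof -
      have "g \<in> I" if "g + m * h \<in> I"
      proof -
        have "(- 1) * (m * h) \<in> I"
          by (rule poly_ring_ideal_mult[OF I mh]) simp
        from poly_ring_ideal_add[OF I that this] show ?thesis by simp
      qed
      moreover have "(g + m * h) * f \<in> I"
        using poly_ring_ideal_add[OF I g(3) poly_ring_ideal_mult[OF I mh f]]
        by (simp add: algebra_simps)
      moreover have "Poly_Mapping.keys (g + m * h) \<subseteq> monomials s"
        using lt ord_monomials by blast
      ultimately show ?thesis
        using g(4) by (auto simp: colon_ideal_def)
    qed
    then have nz: "g + m * h \<noteq> 0"
      using poly_ring_ideal_zero[OF I] by auto
    have "lead_expo ord (g + m * h) \<in> Poly_Mapping.keys (g + m * h)"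
      using lt ord_monomials by (intro lead_expo_in_keys[OF nz]) blast
    with lt nb have "ord_rank (lead_expo ord (g + m * h)) < ord_rank b"
      by (intro ord_rank_less) auto
    with min[OF gm] show False
      by (simp add: b_def)
  qed
  then show ?thesis
    using that[OF g(1-3)] by (simp add: b_def)
qed

end


subsection \<open>Forms as functions on a finite set of vectors\<close>

text \<open>Functions with pointwise operations as a vector space over \<open>K\<close>, so that
  span, independence and the bound on independent sets are available.\<close>

interpretation fun_space: vector_space "\<lambda>(c::'k::field) (u::'v \<Rightarrow> 'k) x. c * u x"
  by unfold_locales (auto simp: fun_eq_iff algebra_simps)

lemma sum_fun_apply: "(\<Sum>x\<in>A. g x) v = (\<Sum>x\<in>A. g x v :: 'k::comm_monoid_add)"
  by (induction A rule: infinite_finite_induct) auto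

text \<open>Extension by zero makes monomials that agree on \<open>W\<close> equal as functions, so
  linear algebra on \<open>W\<close> needs no separate type.\<close>

definition mono_fun :: "(nat \<Rightarrow> 'k::field) set \<Rightarrow> expo \<Rightarrow> (nat \<Rightarrow> 'k) \<Rightarrow> 'k" where
  "mono_fun W b = (\<lambda>v. if v \<in> W then mono_val v b else 0)"

definition form_space :: "nat \<Rightarrow> (nat \<Rightarrow> 'k::field) set \<Rightarrow> nat \<Rightarrow> ((nat \<Rightarrow> 'k) \<Rightarrow> 'k) set" where
  "form_space s W n = fun_space.span (mono_fun W ` {b \<in> monomials s. total_deg b = n})"

lemma form_space_support:
  assumes "u \<in> form_space s W n" "v \<notin> W"
  shows "u v = 0"
  using assms(1) unfolding form_space_def
proof (induction rule: fun_space.span_induct)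
  case (step u)
  then show ?case by (auto simp: mono_fun_def assms(2))
next
  case base
  show ?case by (auto simp: fun_space.subspace_def)
qed

lemma form_space_times_var:
  assumes "u \<in> form_space s W n" "i \<in> {1..s}"
  shows "(\<lambda>v. v i * u v) \<in> form_space s W (Suc n)"
  using assms(1) unfolding form_space_def
proof (induction rule: fun_space.span_induct)
  case (step u)
  then obtain b where b: "b \<in> monomials s" "total_deg b = n" "u = mono_fun W b"
    by auto
  then have "(\<lambda>v. v i * u v) = mono_fun W (b + Poly_Mapping.single i 1)"
    by (auto simp: mono_fun_def mono_val_add fun_eq_iff simp del: One_nat_def)
  moreover have "b + Poly_Mapping.single i 1 \<in> {b \<in> monomials s. total_deg b = Suc n}"
    using b monomials_add[OF b(1) monomials_single[OF assms(2)]] by (simp add: total_deg_add)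
  ultimately show ?case
    by (auto intro!: fun_space.span_base)
next
  case base
  show ?case
    unfolding fun_space.subspace_def
  proof (safe, goal_cases)
    case 1
    show ?case using fun_space.span_zero by (simp add: zero_fun_def)
  next
    case (2 u w)
    from fun_space.span_add[OF this] show ?case
      by (simp add: plus_fun_def distrib_left)
  next
    case (3 c u)
    from fun_space.span_scale[OF this, of c] show ?case
      by (simp add: mult.left_commute)
  qed
qed

text \<open>For each \<open>q\<close> to be separated from \<open>p\<close>, multiply by the linear form \<open>q\<^sub>j x\<^sub>i - q\<^sub>i x\<^sub>j\<close>.\<close>

lemma form_space_separates:
  assumes "finite F" and p: "p \<in> W" "k \<in> {1..s}" "p k \<noteq> 0"
    and "\<forall>q\<in>F. \<exists>i\<in>{1..s}. \<exists>j\<in>{1..s}. p i * q j \<noteq> p j * q i"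
    and "card F \<le> n"
  shows "\<exists>u\<in>form_space s W n. u p \<noteq> 0 \<and> (\<forall>q\<in>F. u q = 0)"
  using assms(1,5,6)
proof (induction F arbitrary: n rule: finite_induct)
  case empty
  \<comment> \<open>The power of \<open>t_k\<close> is nonzero at \<open>p\<close> and absorbs the
    degree left over once each point of \<open>F\<close> has used one linear factor.\<close>
  have "mono_fun W (Poly_Mapping.single k n) \<in> form_space s W n"
    unfolding form_space_def using monomials_single[OF p(2)] by (intro fun_space.span_base) auto
  moreover have "mono_fun W (Poly_Mapping.single k n) p \<noteq> 0"
    using p by (simp add: mono_fun_def mono_val_def)
  ultimately show ?case by auto
next
  case (insert q F)
  then obtain m where m: "n = Suc m" "card F \<le> m"
    by (cases n) auto
  with insert obtain u where u: "u \<in> form_space s W m" "u p \<noteq> 0" "\<forall>q\<in>F. u q = 0"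
    by (metis insertI2)
  from insert.prems obtain i j where ij: "i \<in> {1..s}" "j \<in> {1..s}" "p i * q j \<noteq> p j * q i"
    by auto
  define w where "w = (\<lambda>v. q j * (v i * u v)) - (\<lambda>v. q i * (v j * u v))"
  have "w \<in> form_space s W n"
    using form_space_times_var[OF u(1) ij(1)] form_space_times_var[OF u(1) ij(2)]
    unfolding w_def m form_space_def
    by (intro fun_space.span_diff fun_space.span_scale)
  moreover have "w p = (p i * q j - p j * q i) * u p"
    by (simp add: w_def algebra_simps)
  with ij u(2) have "w p \<noteq> 0"
    by simp
  moreover have "w r = 0" if "r \<in> insert q F" for r
    using that u(3) by (auto simp: w_def)
  ultimately show ?case by blast
qed

text \<open>The indicator functions of the points of \<open>W\<close> are independent. Separating
  forms of degree \<open>n\<close> put them in the span of the monomials from \<open>M\<close>, and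
  an independent set is no larger than a finite spanning set.\<close>

lemma card_le_if_form_space_le_span:
  fixes W :: "(nat \<Rightarrow> 'k::field) set"
  assumes W: "finite W" "\<forall>p\<in>W. \<exists>k\<in>{1..s}. p k \<noteq> 0"
    and sep: "\<And>p q. p \<in> W \<Longrightarrow> q \<in> W \<Longrightarrow> p \<noteq> q \<Longrightarrow>
      \<exists>i\<in>{1..s}. \<exists>j\<in>{1..s}. p i * q j \<noteq> p j * q i"
    and n: "card W \<le> n" and M: "finite M"
    and sub: "form_space s W n \<subseteq> fun_space.span (mono_fun W ` M)"
  shows "card W \<le> card M"
proof -
  define \<delta> :: "(nat \<Rightarrow> 'k) \<Rightarrow> (nat \<Rightarrow> 'k) \<Rightarrow> 'k" where "\<delta> p = (\<lambda>v. if v = p then 1 else 0)" for p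
  have inj: "inj_on \<delta> W"
    by (rule inj_onI) (metis \<delta>_def one_neq_zero)
  have span: "\<delta> ` W \<subseteq> fun_space.span (mono_fun W ` M)"
  proof safe
    fix p assume p: "p \<in> W"
    then obtain k where k: "k \<in> {1..s}" "p k \<noteq> 0"
      using W(2) by blast
    have "card (W - {p}) \<le> n"
      using n card_mono[OF W(1), of "W - {p}"] by simp
    with form_space_separates[of "W - {p}" p W k s n] W(1) p k sep
    obtain u where u: "u \<in> form_space s W n" "u p \<noteq> 0" "\<forall>q\<in>W - {p}. u q = 0"
      by blast
    \<comment> \<open>Rescaling the separating form gives the indicator exactly, because forms were
      extended by zero outside \<open>W\<close>.\<close>
    have "\<delta> p = (\<lambda>v. inverse (u p) * u v)"
    proof
      fix v
      consider "v = p" | "v \<in> W - {p}" | "v \<notin> W" "v \<noteq> p"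
        using p by blast
      then show "\<delta> p v = inverse (u p) * u v"
        by cases (use u form_space_support[OF u(1)] in \<open>simp_all add: \<delta>_def\<close>)
    qed
    moreover have "(\<lambda>v. inverse (u p) * u v) \<in> form_space s W n"
      using u(1) unfolding form_space_def by (rule fun_space.span_scale)
    ultimately show "\<delta> p \<in> fun_space.span (mono_fun W ` M)"
      using sub by auto
  qed
  have indep: "fun_space.independent (\<delta> ` W)"
  proof
    assume "fun_space.dependent (\<delta> ` W)"
    then obtain c x where 0: "(\<Sum>x\<in>\<delta> ` W. (\<lambda>v. c x * x v)) = 0" and x: "x \<in> \<delta> ` W" "c x \<noteq> 0"
      using W(1) by (auto simp: fun_space.dependent_finite)
    then obtain p where p: "p \<in> W" "x = \<delta> p"
      by blast
    have "0 = (\<Sum>x\<in>\<delta> ` W. (\<lambda>v. c x * x v)) p"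
      by (simp add: 0)
    also have "\<dots> = (\<Sum>q\<in>W. c (\<delta> q) * \<delta> q p)"
      by (simp add: sum_fun_apply sum.reindex[OF inj])
    also have "\<dots> = (\<Sum>q\<in>W. if q = p then c (\<delta> p) else 0)"
      by (rule sum.cong) (auto simp: \<delta>_def)
    also have "\<dots> = c x"
      using p W(1) by simp
    finally show False
      using x(2) by simp
  qed
  have "card W = card (\<delta> ` W)"
    by (rule card_image[OF inj, symmetric])
  also have "\<dots> \<le> card (mono_fun W ` M)"
    by (rule conjunct2[OF fun_space.independent_span_bound[OF finite_imageI[OF M] indep span]])
  also have "\<dots> \<le> card M"
    using M by (rule card_image_le)
  finally show ?thesis .
qed

context
  fixes s :: nat and ord :: "expo rel"
  assumes ord: "graded_monomial_order s ord"
begin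

text \<open>One rewriting step: on \<open>W\<close>, the vanishing of a component of
  \<open>h\<close> expresses its leading monomial through smaller ones of the same degree;
  multiplying by the cofactor \<open>c\<close> carries this over to \<open>b\<close>.\<close>

lemma mono_fun_in_span_smaller:
  fixes h :: "'k::field mpoly"
  assumes h: "h \<noteq> 0" "Poly_Mapping.keys h \<subseteq> monomials s"
    and van: "\<And>v. v \<in> W \<Longrightarrow> ray_poly v h = 0"
    and b: "b \<in> monomials s" "\<forall>i. Poly_Mapping.lookup (lead_expo ord h) i \<le> Poly_Mapping.lookup b i"
  shows "mono_fun W b \<in> fun_space.span (mono_fun W `
    {c \<in> monomials s. total_deg c = total_deg b \<and> (c, b) \<in> ord \<and> c \<noteq> b})"
proof -
  obtain c where c: "c \<in> monomials s" "b = lead_expo ord h + c"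
    using monomials_factor[OF b] .
  define l where "l = lead_expo ord h"
  \<comment> \<open>Only the component of the degree of the leading monomial is kept. Its value at
    \<open>v\<close> is a coefficient of \<open>ray_poly v h\<close>, hence zero on
    \<open>W\<close>.\<close>
  define T where "T = {a. a \<in> Poly_Mapping.keys h \<and> total_deg a = total_deg l}"
  have l: "l \<in> T"
    using lead_expo_in_keys[OF ord h] by (simp add: T_def l_def)
  have T: "finite T"
    by (simp add: T_def)
  have lc: "Poly_Mapping.lookup h l \<noteq> 0"
    using l by (simp add: T_def in_keys_iff)
  have "mono_fun W b = (\<Sum>a\<in>T - {l}. (\<lambda>v. - Poly_Mapping.lookup h a / Poly_Mapping.lookup h l *
      mono_fun W (a + c) v))"
  proof
    fix v
    show "mono_fun W b v = (\<Sum>a\<in>T - {l}. (\<lambda>v. - Poly_Mapping.lookup h a / Poly_Mapping.lookup h l *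
      mono_fun W (a + c) v)) v"
    proof (cases "v \<in> W")
      case True
      then have "0 = (\<Sum>a\<in>T. Poly_Mapping.lookup h a * mono_val v a)"
        using lookup_ray_poly[of v h "total_deg l"] van by (simp add: T_def)
      also have "\<dots> = Poly_Mapping.lookup h l * mono_val v l +
          (\<Sum>a\<in>T - {l}. Poly_Mapping.lookup h a * mono_val v a)"
        using T l by (rule sum.remove)
      finally have "mono_val v l =
          - (\<Sum>a\<in>T - {l}. Poly_Mapping.lookup h a * mono_val v a) / Poly_Mapping.lookup h l"
        using lc by (simp add: field_simps eq_neg_iff_add_eq_0)
      also have "\<dots> = (\<Sum>a\<in>T - {l}. - Poly_Mapping.lookup h a / Poly_Mapping.lookup h l * mono_val v a)"
        by (simp add: sum_negf[symmetric] sum_divide_distrib)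
      finally show ?thesis
        using True by (simp add: sum_fun_apply mono_fun_def c(2) l_def[symmetric] mono_val_add
          sum_distrib_right mult.assoc)
    qed (simp add: sum_fun_apply mono_fun_def)
  qed
  also have "\<dots> \<in> fun_space.span (mono_fun W `
    {c \<in> monomials s. total_deg c = total_deg b \<and> (c, b) \<in> ord \<and> c \<noteq> b})"
  proof (intro fun_space.span_sum fun_space.span_scale fun_space.span_base imageI CollectI conjI)
    fix a assume a: "a \<in> T - {l}"
    then have "(a, l) \<in> ord"
      using lead_expo_greatest[OF ord h] by (simp add: T_def l_def)
    then show "(a + c, b) \<in> ord"
      using ord_add[OF ord _ c(1)] by (simp add: c(2) l_def)
    then show "a + c \<in> monomials s"
      using ord_monomials[OF ord] by blast
    show "total_deg (a + c) = total_deg b" "a + c \<noteq> b"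
      using a by (auto simp: T_def l_def c(2) total_deg_add)
  qed
  finally show ?thesis .
qed

text \<open>Rewriting terminates by induction on \<open>ord_rank\<close>: each monomial outside
  \<open>M\<close> is replaced by smaller ones of degree \<open>n\<close>.\<close>

lemma form_space_le_span_reduced:
  fixes W :: "(nat \<Rightarrow> 'k::field) set"
  assumes "\<And>b. b \<in> monomials s \<Longrightarrow> total_deg b = n \<Longrightarrow> b \<notin> M \<Longrightarrow>
    \<exists>h. h \<noteq> 0 \<and> Poly_Mapping.keys h \<subseteq> monomials s \<and> (\<forall>v\<in>W. ray_poly v h = 0) \<and>
      (\<forall>i. Poly_Mapping.lookup (lead_expo ord h) i \<le> Poly_Mapping.lookup b i)"
  shows "form_space s W n \<subseteq> fun_space.span (mono_fun W ` M)"
proof -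
  have "mono_fun W b \<in> fun_space.span (mono_fun W ` M)"
    if "b \<in> monomials s" "total_deg b = n" for b
    using that
  proof (induction "ord_rank ord b" arbitrary: b rule: less_induct)
    case less
    show ?case
    proof (cases "b \<in> M")
      case True
      then show ?thesis
        by (intro fun_space.span_base) simp
    next
      case False
      with assms less.prems obtain h where h: "h \<noteq> 0" "Poly_Mapping.keys h \<subseteq> monomials s"
        "\<forall>v\<in>W. ray_poly v h = 0"
        "\<forall>i. Poly_Mapping.lookup (lead_expo ord h) i \<le> Poly_Mapping.lookup b i"
        by blast
      have "mono_fun W ` {c \<in> monomials s. total_deg c = total_deg b \<and> (c, b) \<in> ord \<and> c \<noteq> b}
          \<subseteq> fun_space.span (mono_fun W ` M)"
        using less ord_rank_less[OF ord] by auto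
      then have "fun_space.span (mono_fun W `
          {c \<in> monomials s. total_deg c = total_deg b \<and> (c, b) \<in> ord \<and> c \<noteq> b})
          \<subseteq> fun_space.span (mono_fun W ` M)"
        by (rule fun_space.span_minimal[OF _ fun_space.subspace_span])
      with mono_fun_in_span_smaller[OF h(1,2) _ less.prems(1) h(4), of W] h(3)
      show ?thesis by blast
    qed
  qed
  then show ?thesis
    unfolding form_space_def
    by (intro fun_space.span_minimal[OF _ fun_space.subspace_span]) auto
qed

end


subsection \<open>Counting the reduced monomials\<close>

text \<open>In fixed degree the exponent of \<open>t_1\<close> is determined by the others, so
  restriction to \<open>{2..s}\<close> is injective. The image lies in the box below
  \<open>e\<close> with the sub-box between \<open>a\<close> and \<open>e\<close> removed. Integers
  avoid truncated subtraction in the product.\<close>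

lemma card_reduced_monomials_le:
  fixes a :: expo and e :: "nat \<Rightarrow> nat"
  assumes s: "s \<ge> 1" and a: "a \<in> monomials s" "\<forall>i\<in>{2..s}. Poly_Mapping.lookup a i < e i"
    and n: "Poly_Mapping.lookup a 1 + (\<Sum>i\<in>{2..s}. e i) \<le> n"
  shows "int (card {b \<in> monomials s. total_deg b = n \<and> (\<forall>i\<in>{2..s}. Poly_Mapping.lookup b i < e i) \<and>
      \<not> (\<forall>i. Poly_Mapping.lookup a i \<le> Poly_Mapping.lookup b i)}) \<le>
    (\<Prod>i\<in>{2..s}. int (e i)) - (\<Prod>i\<in>{2..s}. int (e i) - int (Poly_Mapping.lookup a i))"
    (is "int (card ?M) \<le> _")
proof -
  let ?res = "\<lambda>b :: expo. restrict (Poly_Mapping.lookup b) {2..s}"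
  let ?A = "PiE {2..s} (\<lambda>i. {..<e i})" and ?B = "PiE {2..s} (\<lambda>i. {Poly_Mapping.lookup a i..<e i})"
  have deg: "total_deg b = Poly_Mapping.lookup b 1 + (\<Sum>i\<in>{2..s}. Poly_Mapping.lookup b i)"
    if "b \<in> monomials s" for b
  proof -
    have "{1..s} = insert 1 {2..s}"
      using s by auto
    with that show ?thesis
      by (simp add: total_deg_superset[of "{1..s}"] monomials_def)
  qed
  have inj: "inj_on ?res ?M"
  proof (rule inj_onI)
    fix b c assume b: "b \<in> ?M" and c: "c \<in> ?M" and eq: "?res b = ?res c"
    have eq': "Poly_Mapping.lookup b i = Poly_Mapping.lookup c i" if "i \<in> {2..s}" for i
      using fun_cong[OF eq, of i] that by simp
    then have "(\<Sum>i\<in>{2..s}. Poly_Mapping.lookup b i) = (\<Sum>i\<in>{2..s}. Poly_Mapping.lookup c i)"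
      by (rule sum.cong[OF refl])
    with b c have one: "Poly_Mapping.lookup b 1 = Poly_Mapping.lookup c 1"
      using deg[of b] deg[of c] by simp
    show "b = c"
    proof (rule poly_mapping_eqI)
      fix i
      consider "i = 1" | "i \<in> {2..s}" | "i \<notin> {1..s}"
        by force
      then show "Poly_Mapping.lookup b i = Poly_Mapping.lookup c i"
      proof cases
        case 3
        then have "i \<notin> Poly_Mapping.keys b" "i \<notin> Poly_Mapping.keys c"
          using b c by (auto simp: monomials_def)
        then show ?thesis by (simp add: in_keys_iff)
      qed (use one eq' in auto)
    qed
  qed
  have "?res ` ?M \<subseteq> ?A - ?B"
  proof (rule image_subsetI, rule DiffI)
    fix b assume "b \<in> ?M"
    then have b: "b \<in> monomials s" "total_deg b = n" "\<forall>i\<in>{2..s}. Poly_Mapping.lookup b i < e i"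
      "\<not> (\<forall>i. Poly_Mapping.lookup a i \<le> Poly_Mapping.lookup b i)"
      by simp_all
    show "?res b \<in> ?A"
      using b(3) by auto
    show "?res b \<notin> ?B"
    proof
      assume B: "?res b \<in> ?B"
      have ge: "Poly_Mapping.lookup a i \<le> Poly_Mapping.lookup b i" if "i \<in> {2..s}" for i
        using PiE_mem[OF B that] that by simp
      have "(\<Sum>i\<in>{2..s}. Poly_Mapping.lookup b i) \<le> (\<Sum>i\<in>{2..s}. e i)"
        using b(3) by (intro sum_mono less_imp_le) auto
      \<comment> \<open>Here \<open>n\<close> has to be large: the other variables use at most the
        sum of the \<open>e i\<close>, which leaves at least the exponent of \<open>t_1\<close> in
        \<open>a\<close>.\<close>
      with n b(2) deg[OF b(1)] have one: "Poly_Mapping.lookup a 1 \<le> Poly_Mapping.lookup b 1"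
        by linarith
      have "Poly_Mapping.lookup a i \<le> Poly_Mapping.lookup b i" for i
      proof -
        consider "i = 1" | "i \<in> {2..s}" | "i \<notin> {1..s}"
          by force
        then show ?thesis
        proof cases
          case 3
          then have "i \<notin> Poly_Mapping.keys a"
            using a(1) by (auto simp: monomials_def)
          then show ?thesis by (simp add: in_keys_iff)
        qed (use one ge in auto)
      qed
      with b(4) show False by blast
    qed
  qed
  moreover have finA: "finite ?A" and finB: "finite ?B"
    by (simp_all add: finite_PiE)
  ultimately have "card (?res ` ?M) \<le> card (?A - ?B)"
    by (intro card_mono finite_Diff)
  have BA: "?B \<subseteq> ?A"
    by (rule PiE_mono) auto
  have "card ?M = card (?res ` ?M)"
    by (rule card_image[OF inj, symmetric])
  also note \<open>card (?res ` ?M) \<le> card (?A - ?B)\<close>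
  also have "card (?A - ?B) = card ?A - card ?B"
    by (rule card_Diff_subset[OF finB BA])
  finally have *: "card ?M \<le> card ?A - card ?B" .
  have "card ?B \<le> card ?A"
    by (rule card_mono[OF finA BA])
  with * have "int (card ?M) \<le> int (card ?A) - int (card ?B)"
    by linarith
  also have "int (card ?A) = (\<Prod>i\<in>{2..s}. int (e i))"
    by (simp add: card_PiE)
  also have "int (card ?B) = (\<Prod>i\<in>{2..s}. int (e i) - int (Poly_Mapping.lookup a i))"
    using a(2) by (simp add: card_PiE of_nat_diff less_imp_le)
  finally show ?thesis .
qed


subsection \<open>The number of zeros\<close>

text \<open>If all 2 by 2 minors of \<open>v\<close> and \<open>w\<close> vanish, then
  \<open>v\<close> is a multiple of \<open>w\<close>, with a nonzero factor because \<open>v\<close>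
  is nonzero, and the two classes coincide.\<close>

lemma proj_space_separates:
  fixes P Q :: "(nat \<Rightarrow> 'k::field) set"
  assumes "P \<in> proj_space s" "Q \<in> proj_space s" "P \<noteq> Q" "v \<in> P" "w \<in> Q"
  shows "\<exists>i\<in>{1..s}. \<exists>j\<in>{1..s}. v i * w j \<noteq> v j * w i"
proof (rule ccontr)
  assume "\<not> ?thesis"
  then have eq: "v i * w j = v j * w i" if "i \<in> {1..s}" "j \<in> {1..s}" for i j
    using that by blast
  have v: "v \<in> nonzero_vecs s" and w: "w \<in> nonzero_vecs s"
    using assms in_quotient_imp_subset[OF equiv_proj_rel] unfolding proj_space_def by blast+
  then obtain k where k: "w k \<noteq> 0" "k \<in> {1..s}"
    unfolding nonzero_vecs_def by blast
  have vw: "v i = v k / w k * w i" for i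
  proof (cases "i \<in> {1..s}")
    case True
    with eq[OF True k(2)] k(1) show ?thesis
      by (simp add: field_simps)
  next
    case False
    with v w show ?thesis
      by (simp add: nonzero_vecs_def)
  qed
  have "v k / w k \<noteq> 0"
  proof
    assume 0: "v k / w k = 0"
    have "v i = 0" for i
      using vw[of i] unfolding 0 by simp
    with v show False
      by (simp add: nonzero_vecs_def)
  qed
  with v w vw have "(w, v) \<in> proj_rel s"
    unfolding proj_rel_def by blast
  with assms show False
    using quotient_eq_iff[OF equiv_proj_rel] unfolding proj_space_def by metis
qed

theorem corollary3p8:
  fixes s d :: nat
    and ord :: "expo rel"
    and X :: "(nat \<Rightarrow> 'k::field) set set"
    and f :: "'k mpoly"
    and a :: expo
    and e :: "nat \<Rightarrow> nat"
  assumes "s \<ge> 2"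
    and "graded_monomial_order s ord"
    and "X \<subseteq> proj_space s" and "finite X" and "X \<noteq> {}"
    and "d \<ge> 1"
    and "f \<in> zero_divisor_forms s ord (vanishing_ideal s X) d"
    and "lead_expo ord f = a"
    and "\<forall>i\<in>{2..s}. e i \<ge> 1"
    and "initial_ideal s ord (vanishing_ideal s X) =
         Idl\<^bsub>poly_ring s\<^esub> {pmonom (Poly_Mapping.single i (e i)) | i. i \<in> {2..s}}"
  shows "\<exists>r\<in>{2..s}.
           Poly_Mapping.lookup a r \<ge> 1 \<and>
           (\<forall>i\<in>{r..s}. Poly_Mapping.lookup a i \<le> e i - 1) \<and>
           (\<forall>i. 2 \<le> i \<and> i < r \<longrightarrow> Poly_Mapping.lookup a i = 0) \<and>
           int (card (zeros_in X f)) \<le>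
             (\<Prod>i\<in>{2..s}. int (e i)) - (\<Prod>i\<in>{2..s}. int (e i) - int (Poly_Mapping.lookup a i))"
proof -
  note ord = assms(2)
  define I where "I = vanishing_ideal s X"
  have I: "ideal I (poly_ring s)"
    unfolding I_def by (rule vanishing_ideal_ideal)
  have f: "f \<noteq> 0" "Poly_Mapping.keys f \<subseteq> standard_monomials s ord I"
    "\<And>b. b \<in> Poly_Mapping.keys f \<Longrightarrow> total_deg b = d" "colon_ideal s I f \<noteq> I"
    using assms(7) by (auto simp: zero_divisor_forms_def I_def)
  have fS: "Poly_Mapping.keys f \<subseteq> monomials s"
    using f(2) by (auto simp: standard_monomials_def)
  \<comment> \<open>The hypothesis on the initial ideal becomes a test on the exponents of
    \<open>t_2\<close> to \<open>t_s\<close>.\<close>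
  have in_iff: "(pmonom b :: 'k mpoly) \<in> initial_ideal s ord I \<longleftrightarrow>
      (\<exists>i\<in>{2..s}. e i \<le> Poly_Mapping.lookup b i)" if b: "b \<in> monomials s" for b
  proof -
    have eq: "{pmonom (Poly_Mapping.single i (e i)) | i. i \<in> {2..s}} =
        (pmonom ` (\<lambda>i. Poly_Mapping.single i (e i)) ` {2..s} :: 'k mpoly set)"
      by auto
    have "(\<lambda>i. Poly_Mapping.single i (e i)) ` {2..s} \<subseteq> monomials s"
      by (auto intro: monomials_single)
    from pmonom_mem_monomial_ideal_iff[OF this b, where 'k = 'k]
    have "(pmonom b :: 'k mpoly) \<in> initial_ideal s ord I \<longleftrightarrow> (\<exists>i\<in>{2..s}.
        \<forall>j. Poly_Mapping.lookup (Poly_Mapping.single i (e i)) j \<le> Poly_Mapping.lookup b j)"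
      unfolding I_def assms(10) eq by simp
    then show ?thesis
      by (simp add: lookup_single when_def)
  qed
  \<comment> \<open>The leading monomial of \<open>f\<close> is standard, so each \<open>a_i\<close>
    with \<open>i\<close> at least 2 is below \<open>e i\<close>.\<close>
  have "a \<in> Poly_Mapping.keys f"
    using lead_expo_in_keys[OF ord f(1) fS] assms(8) by simp
  with f(2) have a: "a \<in> monomials s" "\<forall>i\<in>{2..s}. Poly_Mapping.lookup a i < e i"
    using in_iff[of a] by (auto simp: standard_monomials_def not_le)
  have "\<exists>i\<in>{2..s}. Poly_Mapping.lookup a i \<ge> 1"
  proof (rule ccontr)
    assume no: "\<not> ?thesis"
    obtain g where g: "g \<noteq> 0" "Poly_Mapping.keys g \<subseteq> monomials s" "g * f \<in> I"
      "pmonom (lead_expo ord g) \<notin> initial_ideal s ord I"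
      using colon_ideal_standard_witness[OF ord I fS f(4)] .
    have lg: "lead_expo ord g \<in> monomials s"
      using lead_expo_in_keys[OF ord g(1,2)] g(2) by blast
    have "pmonom (lead_expo ord (g * f)) \<in> initial_ideal s ord I"
      using pmonom_mem_initial_ideal_iff[OF ord I] g(3) lead_expo_in_keys[OF ord]
        mult_mpoly_nonzero[OF ord g(1,2) f(1) fS] poly_ring_ideal_carrier[OF I g(3)]
      by blast
    moreover have "lead_expo ord (g * f) = lead_expo ord g + a"
      using lead_expo_mult_eq[OF ord g(1,2) f(1) fS] assms(8) by simp
    ultimately obtain i where i: "i \<in> {2..s}" "e i \<le> Poly_Mapping.lookup (lead_expo ord g + a) i"
      using in_iff[OF monomials_add[OF lg a(1)]] by auto
    \<comment> \<open>With no contribution from \<open>a\<close> at \<open>i\<close>, the leading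
      monomial of \<open>g\<close> alone reaches \<open>e i\<close>, although it is
      standard.\<close>
    from no i(1) have "Poly_Mapping.lookup a i = 0"
      by (simp add: not_le)
    with i have "\<exists>i\<in>{2..s}. e i \<le> Poly_Mapping.lookup (lead_expo ord g) i"
      by (auto simp: lookup_add)
    with g(4) in_iff[OF lg] show False
      by blast
  qed
  \<comment> \<open>Taking \<open>r\<close> least makes all earlier exponents from index 2 on
    vanish.\<close>
  then obtain r where r: "r \<in> {2..s}" "Poly_Mapping.lookup a r \<ge> 1"
    "\<And>i. i < r \<Longrightarrow> \<not> (i \<in> {2..s} \<and> Poly_Mapping.lookup a i \<ge> 1)"
    using exists_least_iff[of "\<lambda>i. i \<in> {2..s} \<and> Poly_Mapping.lookup a i \<ge> 1"] by blast
  \<comment> \<open>One vector per point turns zeros of \<open>f\<close> into a set \<open>W\<close>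
    of vectors of the same size, pairwise not proportional.\<close>
  define rep where "rep P = (SOME v. v \<in> P)" for P :: "(nat \<Rightarrow> 'k) set"
  have rep: "rep P \<in> P" "rep P \<in> nonzero_vecs s" if "P \<in> X" for P
  proof -
    have P: "P \<in> nonzero_vecs s // proj_rel s"
      using that assms(3) by (auto simp: proj_space_def)
    then have "P \<noteq> {}"
      using in_quotient_imp_non_empty[OF equiv_proj_rel] by blast
    then show "rep P \<in> P"
      unfolding rep_def by (simp add: some_in_eq)
    then show "rep P \<in> nonzero_vecs s"
      using in_quotient_imp_subset[OF equiv_proj_rel P] by blast
  qed
  define V where "V = zeros_in X f"
  have V: "P \<in> X" "eval_poly f (rep P) = 0" if "P \<in> V" for P
    using that rep by (auto simp: V_def zeros_in_def vanishes_at_def)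
  define W where "W = rep ` V"
  have sep: "\<exists>i\<in>{1..s}. \<exists>j\<in>{1..s}. rep P i * rep Q j \<noteq> rep P j * rep Q i"
    if "P \<in> V" "Q \<in> V" "P \<noteq> Q" for P Q
    by (rule proj_space_separates[OF subsetD[OF assms(3) V(1)] subsetD[OF assms(3) V(1)] that(3)
      rep(1)[OF V(1)] rep(1)[OF V(1)]]) (rule that)+
  have inj: "inj_on rep V"
  proof (rule inj_onI, rule ccontr)
    fix P Q assume "P \<in> V" "Q \<in> V" "rep P = rep Q" "P \<noteq> Q"
    with sep[of P Q] show False by auto
  qed
  \<comment> \<open>The first two summands make the count of reduced monomials valid;
    \<open>card W\<close> makes the degree large enough to separate the points.\<close>
  define n where "n = Poly_Mapping.lookup a 1 + (\<Sum>i\<in>{2..s}. e i) + card W"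
  define M where "M = {b \<in> monomials s. total_deg b = n \<and>
    (\<forall>i\<in>{2..s}. Poly_Mapping.lookup b i < e i) \<and>
    \<not> (\<forall>i. Poly_Mapping.lookup a i \<le> Poly_Mapping.lookup b i)}"
  have "card W \<le> card M"
  proof (rule card_le_if_form_space_le_span[where s = s and n = n])
    show "finite W"
      using assms(4) by (simp add: W_def V_def zeros_in_def)
    show "\<forall>p\<in>W. \<exists>k\<in>{1..s}. p k \<noteq> 0"
    proof
      fix p assume "p \<in> W"
      then have "p \<in> nonzero_vecs s"
        using rep(2) V(1) by (auto simp: W_def)
      then show "\<exists>k\<in>{1..s}. p k \<noteq> 0"
        unfolding nonzero_vecs_def by blast
    qed
    show "\<exists>i\<in>{1..s}. \<exists>j\<in>{1..s}. p i * q j \<noteq> p j * q i"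
      if "p \<in> W" "q \<in> W" "p \<noteq> q" for p q
      using that sep unfolding W_def by blast
    show "card W \<le> n"
      by (simp add: n_def)
    show "finite M"
      by (rule finite_subset[OF _ finite_monomials_le[of s n]]) (auto simp: M_def)
    show "form_space s W n \<subseteq> fun_space.span (mono_fun W ` M)"
    proof (rule form_space_le_span_reduced[OF ord])
      fix b assume b: "b \<in> monomials s" "total_deg b = n" "b \<notin> M"
      show "\<exists>h. h \<noteq> 0 \<and> Poly_Mapping.keys h \<subseteq> monomials s \<and> (\<forall>v\<in>W. ray_poly v h = 0) \<and>
        (\<forall>i. Poly_Mapping.lookup (lead_expo ord h) i \<le> Poly_Mapping.lookup b i)"
      \<comment> \<open>A monomial outside \<open>M\<close> is either divisible by the leading
        monomial of \<open>f\<close>, and \<open>f\<close> itself rewrites it, or lies in the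
        initial ideal, and an element of \<open>I\<close> does.\<close>
      proof (cases "\<forall>i. Poly_Mapping.lookup a i \<le> Poly_Mapping.lookup b i")
        case True
        have "ray_poly v f = 0" if "v \<in> W" for v
          using that V f(3) unfolding W_def
          by (intro ray_poly_homogeneous) (auto simp: homogeneous_def)
        with f(1) fS True assms(8) show ?thesis by blast
      next
        case False
        with b have "(pmonom b :: 'k mpoly) \<in> initial_ideal s ord I"
          using in_iff by (auto simp: M_def not_less)
        then obtain h where h: "h \<in> I" "h \<noteq> 0"
          "\<forall>i. Poly_Mapping.lookup (lead_expo ord h) i \<le> Poly_Mapping.lookup b i"
          using pmonom_mem_initial_ideal_iff[OF ord I b(1)] by blast
        moreover have "ray_poly v h = 0" if "v \<in> W" for v
          using that h(1) V(1) rep(1) unfolding W_def I_def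
          by (auto intro: vanishing_ideal_ray_poly)
        ultimately show ?thesis
          using poly_ring_ideal_carrier[OF I h(1)] by blast
      qed
    qed
  qed
  then have "int (card V) \<le> int (card M)"
    by (simp add: W_def card_image[OF inj])
  also have "\<dots> \<le> (\<Prod>i\<in>{2..s}. int (e i)) - (\<Prod>i\<in>{2..s}. int (e i) - int (Poly_Mapping.lookup a i))"
    unfolding M_def using assms(1) a by (intro card_reduced_monomials_le) (auto simp: n_def)
  finally have "int (card (zeros_in X f)) \<le> (\<Prod>i\<in>{2..s}. int (e i)) -
      (\<Prod>i\<in>{2..s}. int (e i) - int (Poly_Mapping.lookup a i))"
    by (simp add: V_def)
  moreover have "\<forall>i\<in>{r..s}. Poly_Mapping.lookup a i \<le> e i - 1"
  proof
    fix i assume "i \<in> {r..s}"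
    with r(1) have "Poly_Mapping.lookup a i < e i"
      using a(2) by simp
    then show "Poly_Mapping.lookup a i \<le> e i - 1"
      by simp
  qed
  moreover have "\<forall>i. 2 \<le> i \<and> i < r \<longrightarrow> Poly_Mapping.lookup a i = 0"
  proof (intro allI impI)
    fix i assume "2 \<le> i \<and> i < r"
    with r(1) r(3)[of i] show "Poly_Mapping.lookup a i = 0"
      by simp
  qed
  ultimately show ?thesis
    using r by blast
qed

end
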